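(* Let $\mathcal{A}$ be a ternary algebra, and assume that there exist $B_0, C_0 \in \mathcal{A}^{\times}$ such that $A \cdot B_0^* \cdot C_0 = A$ for all $A \in \mathcal{A}$. Let $\mathcal{R}$ be the collection of formal symbols $A \cdot B^*$ with $A, B \in \mathcal{A}$, modulo the equivalence relation $A \cdot B^* \sim C \cdot D^*$ whenever $A \cdot B^* \cdot C_0 = C \cdot D^* \cdot C_0$ in $\mathcal{A}$. Then $\mathcal{R}$ (with the operations described in the context) is a commutative ring with identity, and $\mathcal{A}$ is a left $\mathcal{R}$-module.
   Context: A ternary algebra is a finite-dimensional vector space $\mathcal{A}$ over $\mathbb{Q}$, equipped with a triple product $\mathcal{A}\times\mathcal{A}\times\mathcal{A} \to \mathcal{A}$, $(A,B,C) \mapsto A \cdot B^* \cdot C$ (here $B^*$ is only part of the notation for the triple product) and a function $\det : \mathcal{A} \to \mathbb{Q}$, such that for all $\alpha \in \mathbb{Q}$ and $A,B,C,D,E \in \mathcal{A}$: (1) $A \cdot B^* \cdot C \in \mathcal{A}$; (2) $A \cdot B^* \cdot C = C \cdot B^* \cdot A$; (3) $(A \cdot B^* \cdot C) \cdot D^* \cdot E = A \cdot B^* \cdot (C \cdot D^* \cdot E)$; (4) $(A + D) \cdot B^* \cdot C = A \cdot B^* \cdot C + D \cdot B^* \cdot C$; (5) $(\alpha A) \cdot B^* \cdot C = \alpha (A \cdot B^* \cdot C) = A \cdot B^* \cdot (\alpha C)$; (6) $A \cdot A^* \cdot A = 0$ if and only if $\det A = 0$. $\mathcal{A}^{\times}$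 denotes the set of $A \in \mathcal{A}$ with $\det A \neq 0$. Operations on $\mathcal{R}$: every symbol $A \cdot B^*$ is equivalent to a symbol of the form $A' \cdot B_0^*$, with $A' = A \cdot B_0^* \cdot (C_0 \cdot B^* \cdot C_0)$. On classes of symbols $g = A \cdot B_0^*$ and $h = B \cdot B_0^*$ one sets $g + h = (A + B) \cdot B_0^*$ and $g \cdot h = (A \cdot B_0^* \cdot B) \cdot B_0^*$. The action of $g = A \cdot B_0^* \in \mathcal{R}$ on $C \in \mathcal{A}$ is $g \cdot C = A \cdot B_0^* \cdot C \in \mathcal{A}$. *)

theory Defs
  imports Complex_Main "HOL-Algebra.Module"
begin

text \<open>
  The whole type \<open>'a\<close> is the underlying vector space, so closure under the triple product is
  expressed by the type of \<open>tri\<close>, where \<open>tri A B C\<close> stands for \<open>A \<cdot> B\<^sup>* \<cdot> C\<close>. No additivity or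
  homogeneity in the middle argument is required. The function \<open>dt\<close> is the determinant.
\<close>

locale ternary_algebra = vector_space scale
  for scale :: "rat \<Rightarrow> 'a::ab_group_add \<Rightarrow> 'a" +
  fixes tri :: "'a \<Rightarrow> 'a \<Rightarrow> 'a \<Rightarrow> 'a"
    and dt :: "'a \<Rightarrow> rat"
  assumes finite_dim: "\<exists>S. finite S \<and> span S = UNIV"
    and tri_commute: "tri A B C = tri C B A"
    and tri_assoc: "tri (tri A B C) D E = tri A B (tri C D E)"
    and tri_add_left: "tri (A + D) B C = tri A B C + tri D B C"
    and tri_scale_left: "tri (scale \<alpha> A) B C = scale \<alpha> (tri A B C)"
    and tri_scale_right: "scale \<alpha> (tri A B C) = tri A B (scale \<alpha> C)"
    and tri_self_eq_0_iff: "tri A A A = 0 \<longleftrightarrow> dt A = 0"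

definition det_nonzero :: "('a \<Rightarrow> rat) \<Rightarrow> 'a set" where
  "det_nonzero dt = {A. dt A \<noteq> 0}"

text \<open>The formal symbol \<open>A \<cdot> B\<^sup>*\<close> is encoded as the pair \<open>(A, B)\<close>.\<close>

definition symbol_rel :: "('a \<Rightarrow> 'a \<Rightarrow> 'a \<Rightarrow> 'a) \<Rightarrow> 'a \<Rightarrow> (('a \<times> 'a) \<times> ('a \<times> 'a)) set" where
  "symbol_rel tri C0 = {((A, B), (C, D)). tri A B C0 = tri C D C0}"

definition symbol_class :: "('a \<Rightarrow> 'a \<Rightarrow> 'a \<Rightarrow> 'a) \<Rightarrow> 'a \<Rightarrow> 'a \<Rightarrow> 'a \<Rightarrow> ('a \<times> 'a) set" where
  "symbol_class tri C0 A B = symbol_rel tri C0 `` {(A, B)}"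

text \<open>
  The operations on classes are given by representatives whose second component is \<open>B0\<close>. As usual
  for quotients, the union over all such representatives of \<open>g\<close> and \<open>h\<close> is a single class exactly
  when such representatives exist and the result does not depend on their choice.
\<close>

definition symbol_add ::
  "('a::ab_group_add \<Rightarrow> 'a \<Rightarrow> 'a \<Rightarrow> 'a) \<Rightarrow> 'a \<Rightarrow> 'a \<Rightarrow> ('a \<times> 'a) set \<Rightarrow> ('a \<times> 'a) set \<Rightarrow> ('a \<times> 'a) set"
  where
  "symbol_add tri B0 C0 g h =
    (\<Union>A\<in>{A. (A, B0) \<in> g}. \<Union>B\<in>{B. (B, B0) \<in> h}. symbol_class tri C0 (A + B) B0)"

definition symbol_mult ::
  "('a \<Rightarrow> 'a \<Rightarrow> 'a \<Rightarrow> 'a) \<Rightarrow> 'a \<Rightarrow> 'a \<Rightarrow> ('a \<times> 'a) set \<Rightarrow> ('a \<times> 'a) set \<Rightarrow> ('a \<times> 'a) set" where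
  "symbol_mult tri B0 C0 g h =
    (\<Union>A\<in>{A. (A, B0) \<in> g}. \<Union>B\<in>{B. (B, B0) \<in> h}. symbol_class tri C0 (tri A B0 B) B0)"

definition symbol_act :: "('a \<Rightarrow> 'a \<Rightarrow> 'a \<Rightarrow> 'a) \<Rightarrow> 'a \<Rightarrow> ('a \<times> 'a) set \<Rightarrow> 'a \<Rightarrow> 'a" where
  "symbol_act tri B0 g C = (THE D. \<exists>A. (A, B0) \<in> g \<and> D = tri A B0 C)"

definition symbol_ring ::
  "('a::ab_group_add \<Rightarrow> 'a \<Rightarrow> 'a \<Rightarrow> 'a) \<Rightarrow> 'a \<Rightarrow> 'a \<Rightarrow> ('a \<times> 'a) set ring" where
  "symbol_ring tri B0 C0 =
    \<lparr>carrier = UNIV // symbol_rel tri C0,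
     mult = symbol_mult tri B0 C0,
     one = symbol_class tri C0 C0 B0,
     zero = symbol_class tri C0 0 B0,
     add = symbol_add tri B0 C0\<rparr>"

text \<open>
  The library's module records extend ring records; the module axioms do not mention the fields
  \<open>mult\<close> and \<open>one\<close>, which are therefore left undefined.
\<close>

definition symbol_module ::
  "('a::ab_group_add \<Rightarrow> 'a \<Rightarrow> 'a \<Rightarrow> 'a) \<Rightarrow> 'a \<Rightarrow> (('a \<times> 'a) set, 'a) module" where
  "symbol_module tri B0 =
    \<lparr>carrier = UNIV, mult = undefined, one = undefined, zero = 0, add = (+),
     smult = symbol_act tri B0\<rparr>"

end

theory Submission
  imports Defs
begin

text \<open>
  Because \<open>A \<cdot> B0\<^sup>* \<cdot> C0 = A\<close>, the map \<open>A \<mapsto> A \<cdot> B0\<^sup>*\<close> is a bijection from the algebra to the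
  classes of symbols, so everything can be checked on the algebra itself, with the product
  \<open>A \<cdot> B0\<^sup>* \<cdot> B\<close> and the unit \<open>C0\<close>. The module is then the regular one.
\<close>

locale unital_ternary_algebra = ternary_algebra scale tri dt
  for scale :: "rat \<Rightarrow> 'a::ab_group_add \<Rightarrow> 'a" and tri dt +
  fixes B0 C0 :: 'a
  assumes tri_unit_right: "tri A B0 C0 = A"
begin

abbreviation symbol :: "'a \<Rightarrow> ('a \<times> 'a) set" where
  "symbol A \<equiv> symbol_class tri C0 A B0"

abbreviation R :: "('a \<times> 'a) set ring" where
  "R \<equiv> symbol_ring tri B0 C0"

abbreviation M :: "(('a \<times> 'a) set, 'a) module" where
  "M \<equiv> symbol_module tri B0"

lemma tri_unit_left: "tri C0 B0 A = A"
  by (metis tri_commute tri_unit_right)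

lemma tri_add_right: "tri A B (C + D) = tri A B C + tri A B D"
  by (metis tri_commute tri_add_left)

text \<open>The relation is the kernel of the map \<open>(A, B)\<close> to
  \<open>tri A B C0\<close>.\<close>

lemma equiv_symbol_rel: "equiv UNIV (symbol_rel tri C0)"
  by (auto simp: equiv_def refl_on_def sym_def trans_def symbol_rel_def)

text \<open>Reassociating gives \<open>tri A B0 (tri C0 B C0) = tri (tri A B0 C0) B C0\<close>, and
  the unit law reduces the inner product to \<open>A\<close>.\<close>

lemma symbol_rel_normal_form: "((A, B), (tri A B0 (tri C0 B C0), B0)) \<in> symbol_rel tri C0"
  by (simp add: symbol_rel_def tri_unit_right flip: tri_assoc)

lemma mem_symbol_iff: "(X, Y) \<in> symbol A \<longleftrightarrow> tri X Y C0 = A"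
  by (auto simp: symbol_class_def symbol_rel_def tri_unit_right)

text \<open>This settles well-definedness: the unions defining the operations run over singletons,
  so no choice of representatives is left.\<close>

lemma representatives_symbol: "{X. (X, B0) \<in> symbol A} = {A}"
  by (simp add: mem_symbol_iff tri_unit_right)

text \<open>The normal form makes \<open>symbol\<close> surjective onto the classes, so ring laws
  need checking only on its values.\<close>

lemma carrier_R: "carrier R = range symbol"
proof -
  have "symbol_class tri C0 A B = symbol (tri A B0 (tri C0 B C0))" for A B
    unfolding symbol_class_def
    using equiv_class_eq[OF equiv_symbol_rel symbol_rel_normal_form] .
  then show ?thesis
    by (auto simp: symbol_ring_def quotient_def symbol_class_def)
qed

lemma add_symbol: "symbol A \<oplus>\<^bsub>R\<^esub> symbol B = symbol (A + B)"
  by (simp add: symbol_ring_def symbol_add_def representatives_symbol)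

lemma mult_symbol: "symbol A \<otimes>\<^bsub>R\<^esub> symbol B = symbol (tri A B0 B)"
  by (simp add: symbol_ring_def symbol_mult_def representatives_symbol)

lemma one_R: "\<one>\<^bsub>R\<^esub> = symbol C0"
  by (simp add: symbol_ring_def)

lemma zero_R: "\<zero>\<^bsub>R\<^esub> = symbol 0"
  by (simp add: symbol_ring_def)

text \<open>The description has exactly one candidate, since \<open>A\<close> is the only first
  component paired with \<open>B0\<close> in its class.\<close>

lemma act_symbol: "symbol A \<odot>\<^bsub>M\<^esub> C = tri A B0 C"
  by (simp add: symbol_module_def symbol_act_def mem_symbol_iff tri_unit_right)

lemmas symbol_simps = carrier_R add_symbol mult_symbol one_R zero_R

lemma cring_R: "cring R"
proof (rule cringI)
  show "abelian_group R"
  proof (rule abelian_groupI)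
    fix x assume "x \<in> carrier R"
    then obtain A where "x = symbol A"
      by (auto simp: carrier_R)
    then show "\<exists>y\<in>carrier R. y \<oplus>\<^bsub>R\<^esub> x = \<zero>\<^bsub>R\<^esub>"
      by (auto simp: symbol_simps intro!: exI[of _ "- A"])
  qed (auto simp: symbol_simps ac_simps)
  show "comm_monoid R"
  proof (rule comm_monoidI)
    fix x y assume "x \<in> carrier R" "y \<in> carrier R"
    then obtain A B where "x = symbol A" "y = symbol B"
      by (auto simp: carrier_R)
    \<comment> \<open>With the middle argument fixed at \<open>B0\<close>, exchanging the outer
      arguments exchanges the factors.\<close>
    then show "x \<otimes>\<^bsub>R\<^esub> y = y \<otimes>\<^bsub>R\<^esub> x"
      by (simp add: mult_symbol tri_commute[of A])
  qed (auto simp: symbol_simps tri_assoc tri_unit_left)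
\<comment> \<open>One distributive law is left; commutativity supplies the other.\<close>
qed (auto simp: symbol_simps tri_add_left)

lemma carrier_M: "carrier M = UNIV"
  and add_M: "A \<oplus>\<^bsub>M\<^esub> B = A + B"
  and zero_M: "\<zero>\<^bsub>M\<^esub> = 0"
  by (simp_all add: symbol_module_def)

lemma module_M: "Module.module R M"
proof (rule moduleI)
  show "abelian_group M"
  proof (rule abelian_groupI)
    fix x assume "x \<in> carrier M"
    show "\<exists>y\<in>carrier M. y \<oplus>\<^bsub>M\<^esub> x = \<zero>\<^bsub>M\<^esub>"
      by (auto simp: carrier_M add_M zero_M intro!: exI[of _ "- x"])
  qed (simp_all add: carrier_M add_M zero_M ac_simps)
\<comment> \<open>Additivity in each outer argument gives the two distributive laws, and
  \<open>tri_assoc\<close> the compatibility of the action with the ring product.\<close>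
qed (auto simp: cring_R symbol_simps act_symbol carrier_M add_M tri_add_left tri_add_right
    tri_assoc tri_unit_left)

end

theorem proposition2p3:
  fixes scale :: "rat \<Rightarrow> 'a::ab_group_add \<Rightarrow> 'a"
    and tri :: "'a \<Rightarrow> 'a \<Rightarrow> 'a \<Rightarrow> 'a"
    and dt :: "'a \<Rightarrow> rat"
    and B0 C0 :: 'a
  assumes "ternary_algebra scale tri dt"
    and "B0 \<in> det_nonzero dt" and "C0 \<in> det_nonzero dt"
    and "\<And>A. tri A B0 C0 = A"
  shows "equiv UNIV (symbol_rel tri C0)
    \<and> (\<forall>A B. ((A, B), (tri A B0 (tri C0 B C0), B0)) \<in> symbol_rel tri C0)
    \<and> (\<forall>A B. symbol_class tri C0 A B0 \<oplus>\<^bsub>symbol_ring tri B0 C0\<^esub> symbol_class tri C0 B B0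
          = symbol_class tri C0 (A + B) B0)
    \<and> (\<forall>A B. symbol_class tri C0 A B0 \<otimes>\<^bsub>symbol_ring tri B0 C0\<^esub> symbol_class tri C0 B B0
          = symbol_class tri C0 (tri A B0 B) B0)
    \<and> (\<forall>A C. symbol_class tri C0 A B0 \<odot>\<^bsub>symbol_module tri B0\<^esub> C = tri A B0 C)
    \<and> cring (symbol_ring tri B0 C0)
    \<and> Module.module (symbol_ring tri B0 C0) (symbol_module tri B0)"
proof -
  interpret ternary_algebra scale tri dt
    by (fact assms(1))
  interpret unital_ternary_algebra scale tri dt B0 C0
    by unfold_locales (fact assms(4))
  show ?thesis
    using equiv_symbol_rel symbol_rel_normal_form add_symbol mult_symbol act_symbol cring_R module_M
    by blast
qed

end
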